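(* Suppose consecutive letters are drawn (independently and uniformly at random) from $\{1,2,\ldots,n\}$ until a soft streak of $k$ is obtained, i.e. until the last $k$ letters drawn form a non-decreasing word of length $k$. Then the expected number of letters drawn is given by $$E_{\mathrm{soft}}(n,k)=\frac{\left(1-n^{-k}\right)^n}{\displaystyle\sum_{r=0}^{(k-1)n}\psi_{k,r}\,\mathcal{B}(n,k,r)\,n^{-r}}=\frac{k}{\displaystyle\sum_{s=1}^{k-1}\left(1-\omega_k^{-s}\right)\left(1-\frac{\omega_k^{s}}{n}\right)^{-n}}.$$
   Context: Here $n$ is a positive integer (the alphabet size) and $k\ge 2$ is an integer. A soft streak of length $k$ (or soft streak of $k$) is a non-decreasing word of length $k$; in a sequence of letters it is a block of $k$ consecutive letters that is non-decreasing. $\omega_k=e^{2\pi i/k}$. For $r\in\mathbb{Z}$, $\psi_{k,r}=1$ if $r\equiv 0\pmod k$, $\psi_{k,r}=-1$ if $r\equiv 1\pmod k$, and $\psi_{k,r}=0$ otherwise. $\mathcal{B}(n,k,r)$ is the coefficient of $x^r$ in the expansion of $(1+x+x^2+\cdots+x^{k-1})^n$.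
   Formalization: The first formula is asserted only for n ≥ 2, because for n = 1 its numerator and denominator are both 0 and the quotient is undefined; the second formula, with roots of unity, is asserted for all n ≥ 1. *)

theory Defs
  imports "HOL-Probability.Probability" "HOL-Computational_Algebra.Polynomial"
    "HOL-Number_Theory.Cong"
begin

definition soft_streak :: "nat \<Rightarrow> nat list \<Rightarrow> bool" where
  "soft_streak k w \<longleftrightarrow> length w = k \<and> sorted w"

(* x i is the (i+1)-st letter, so after m letters the last k of them are
   x (m-k), ..., x (m-1).  The infimum is \<infinity> if no soft streak of k ever occurs. *)
definition letters_drawn :: "nat \<Rightarrow> (nat \<Rightarrow> nat) \<Rightarrow> enat" where
  "letters_drawn k x = (INF m \<in> {m. k \<le> m \<and> soft_streak k (map x [m - k..<m])}. enat m)"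

definition expected_letters :: "'a measure \<Rightarrow> (nat \<Rightarrow> 'a \<Rightarrow> nat) \<Rightarrow> nat \<Rightarrow> ennreal" where
  "expected_letters M X k = (\<integral>\<^sup>+ \<xi>. ennreal_of_enat (letters_drawn k (\<lambda>i. X i \<xi>)) \<partial>M)"

definition iid_uniform_letters :: "'a measure \<Rightarrow> (nat \<Rightarrow> 'a \<Rightarrow> nat) \<Rightarrow> nat \<Rightarrow> bool" where
  "iid_uniform_letters M X n \<longleftrightarrow>
     prob_space M \<and>
     prob_space.indep_vars M (\<lambda>_. count_space UNIV) X UNIV \<and>
     (\<forall>i. distr M (count_space UNIV) (X i) = measure_pmf (pmf_of_set {1..n}))"

definition root_omega :: "nat \<Rightarrow> complex" where
  "root_omega k = exp (2 * of_real pi * \<i> / of_nat k)"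

definition psi :: "nat \<Rightarrow> int \<Rightarrow> int" where
  "psi k r = (if [r = 0] (mod int k) then 1 else if [r = 1] (mod int k) then -1 else 0)"

definition calB :: "nat \<Rightarrow> nat \<Rightarrow> nat \<Rightarrow> nat" where
  "calB n k r = coeff ((\<Sum>i<k. monom (1::nat) i) ^ n) r"

end

theory Submission
  imports Defs
begin

text \<open>
  Let \<open>a m\<close> count the words of length \<open>m\<close> without a soft streak and \<open>h r\<close> the non-decreasing words
  of length \<open>r\<close>.  The tail of the waiting time is \<open>P (T > m) = a m / n ^ m\<close>, so the expectation is
  the generating function of \<open>a\<close> at \<open>1 / n\<close>.  Splitting a word into a streak-free prefix and a
  non-decreasing suffix in all possible ways, weighted by \<open>psi\<close> of the suffix length, gives
  \<open>(\<Sum>m. a m * z ^ m) * (\<Sum>r. psi r * h r * z ^ r) = 1\<close>.  As \<open>(\<Sum>r. h r * z ^ r) = (1 - z) powi (- n)\<close>,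
  writing \<open>psi\<close> as a combination of \<open>k\<close>-th roots of unity evaluates the second factor; the formula
  with \<open>calB\<close> follows on multiplying by \<open>(1 - z ^ k) ^ n\<close>.  For \<open>n = 1\<close> the point \<open>1 / n\<close> lies on the
  circle of convergence of the second series, but there \<open>T = k\<close> almost surely.
\<close>

section \<open>Words, streak avoidance and splitting a word in two\<close>

definition words :: "nat \<Rightarrow> nat \<Rightarrow> nat list set" where
  "words n m = {w. set w \<subseteq> {1..n} \<and> length w = m}"

definition avoids :: "nat \<Rightarrow> nat list \<Rightarrow> bool" where
  "avoids k w \<longleftrightarrow> (\<forall>j. j + k \<le> length w \<longrightarrow> \<not> sorted (take k (drop j w)))"

definition avoid_count :: "nat \<Rightarrow> nat \<Rightarrow> nat \<Rightarrow> nat" where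
  "avoid_count n k m = card {w \<in> words n m. avoids k w}"

definition sorted_count :: "nat \<Rightarrow> nat \<Rightarrow> nat" where
  "sorted_count n r = card {w \<in> words n r. sorted w}"

lemma finite_words: "finite (words n m)"
  unfolding words_def by (rule finite_lists_length_eq) simp

lemma card_words: "card (words n m) = n ^ m"
  unfolding words_def by (subst card_lists_length_eq) auto

lemma bij_betw_append_words:
  "bij_betw (\<lambda>(u, v). u @ v) ({u \<in> words n i. P u} \<times> {v \<in> words n j. Q v})
     {w \<in> words n (i + j). P (take i w) \<and> Q (drop i w)}"
proof (rule bij_betwI[where g = "\<lambda>w. (take i w, drop i w)"])
  show "(\<lambda>w. (take i w, drop i w)) \<in> {w \<in> words n (i + j). P (take i w) \<and> Q (drop i w)} \<rightarrow>
      {u \<in> words n i. P u} \<times> {v \<in> words n j. Q v}"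
    by (auto simp: words_def dest: in_set_takeD in_set_dropD)
qed (auto simp: words_def subset_iff)

text \<open>Prefix and suffix of a word can be chosen independently. \<open>P\<close> and
  \<open>Q\<close> stay general because \<open>avoids k\<close> is later paired with
  \<open>sorted\<close> for the convolution identity and with its negation for the decay of the
  tail.\<close>

lemma card_append_words:
  "card {w \<in> words n (i + j). P (take i w) \<and> Q (drop i w)} =
     card {u \<in> words n i. P u} * card {v \<in> words n j. Q v}"
  using bij_betw_same_card[OF bij_betw_append_words[of n i P j Q]]
  by (simp add: card_cartesian_product)

text \<open>Indexing adjacent pairs by their position in \<open>w\<close> lets suffixes and windows
  with different starting points be compared and glued.\<close>

lemma sorted_drop_iff:
  "sorted (drop a w) \<longleftrightarrow> (\<forall>i\<ge>a. Suc i < length w \<longrightarrow> w ! i \<le> w ! Suc i)"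
  (is "_ \<longleftrightarrow> ?R")
proof
  assume L: "sorted (drop a w)"
  show ?R
  proof (intro allI impI)
    fix i assume "a \<le> i" "Suc i < length w"
    then show "w ! i \<le> w ! Suc i"
      using L[unfolded sorted_iff_nth_Suc, rule_format, of "i - a"] by simp
  qed
next
  assume ?R then show "sorted (drop a w)"
    by (auto simp: sorted_iff_nth_Suc)
qed

lemma sorted_window_iff:
  assumes "j + k \<le> length w"
  shows "sorted (take k (drop j w)) \<longleftrightarrow> (\<forall>i\<ge>j. Suc i < j + k \<longrightarrow> w ! i \<le> w ! Suc i)"
proof -
  have "take k (drop j w) = drop j (take (j + k) w)"
    by (simp add: drop_take)
  then show ?thesis
    using assms by (simp add: sorted_drop_iff)
qed

lemma avoids_take_iff:
  assumes "i \<le> length w"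
  shows "avoids k (take i w) \<longleftrightarrow> (\<forall>j. j + k \<le> i \<longrightarrow> \<not> sorted (take k (drop j w)))"
  using assms by (auto simp: avoids_def drop_take min_def)

section \<open>Vanishing sums of \<open>psi\<close> and the convolution identity\<close>

lemma psi_add_period: "psi k (int (r + k)) = psi k (int r)"
  by (simp add: psi_def cong_def)

lemma psi_initial:
  assumes "k \<ge> 2" "r < k"
  shows "psi k (int r) = (if r = 0 then 1 else if r = 1 then -1 else 0)"
  using assms by (simp add: psi_def cong_def)

lemma sum_psi_initial:
  assumes "k \<ge> 2" "1 \<le> q" "q < k"
  shows "(\<Sum>r\<in>{0..q}. psi k (int r)) = 0"
proof -
  have "(\<Sum>r\<in>{0..q}. psi k (int r)) = (\<Sum>r\<in>{0,1}. psi k (int r))"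
    using assms by (intro sum.mono_neutral_right) (auto simp: psi_initial)
  also have "\<dots> = 0"
    using psi_initial[of k 0] psi_initial[of k 1] assms by simp
  finally show ?thesis .
qed

text \<open>Shifting the block by one drops \<open>psi\<close> at \<open>l\<close> and adds it at
  \<open>l + k\<close>, which is the same value; the base case is a full initial block.\<close>

lemma sum_psi_period:
  assumes "k \<ge> 2"
  shows "(\<Sum>r\<in>{l..<l+k}. psi k (int r)) = 0"
proof (induction l)
  case 0
  have "{0..<k} = {0..k-1}" using assms by auto
  then show ?case using sum_psi_initial[of k "k-1"] assms by simp
next
  case (Suc l)
  have "(\<Sum>r\<in>{l..<Suc (l+k)}. psi k (int r)) = psi k (int l) + (\<Sum>r\<in>{Suc l..<Suc (l+k)}. psi k (int r))"
    by (rule sum.atLeast_Suc_lessThan) simp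
  moreover have "(\<Sum>r\<in>{l..<Suc (l+k)}. psi k (int r)) = (\<Sum>r\<in>{l..<l+k}. psi k (int r)) + psi k (int (l + k))"
    by (rule sum.atLeastLessThan_Suc) simp
  ultimately show ?case using Suc psi_add_period[of k l] by simp
qed

text \<open>
  The admissible suffix lengths \<open>r\<close> form \<open>{0..q}\<close> with \<open>1 \<le> q < k\<close> if \<open>w\<close> avoids streaks; otherwise they
  are absent or \<open>k\<close> consecutive numbers, because the non-decreasing run that contains the first
  streak of \<open>w\<close> also starts with it.
\<close>

lemma sum_psi_splits_eq_0:
  assumes k: "k \<ge> 2" and m: "length w = m" "m \<ge> 1"
  defines "R \<equiv> {r. r \<le> m \<and> avoids k (take (m - r) w) \<and> sorted (drop (m - r) w)}"
  shows "(\<Sum>r\<in>R. psi k (int r)) = 0"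
proof (cases "avoids k w")
  case True
  define S where "S = {r. r \<le> m \<and> sorted (drop (m - r) w)}"
  define q where "q = Max S"
  \<comment> \<open>Every prefix of an avoiding word avoids, so only sortedness of the suffix
    restricts \<open>r\<close>.\<close>
  have "R = S"
    using True m avoids_take_iff[of _ w k] by (auto simp: R_def S_def avoids_def)
  have fin: "finite S" by (simp add: S_def)
  have S1: "1 \<in> S" using m by (auto simp: S_def sorted_drop_iff)
  have qS: "q \<in> S" unfolding q_def using fin S1 by (intro Max_in) auto
  \<comment> \<open>A suffix of a sorted suffix is sorted, so \<open>S\<close> is closed
    downwards.\<close>
  have "S = {0..q}"
  proof
    show "S \<subseteq> {0..q}" using fin by (auto simp: q_def)
    show "{0..q} \<subseteq> S" using qS by (auto simp: S_def sorted_drop_iff)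
  qed
  moreover have "1 \<le> q" using S1 fin by (simp add: q_def)
  moreover have "q < k"
  proof (rule ccontr)
    assume "\<not> q < k"
    then have "k \<in> S" using \<open>S = {0..q}\<close> by auto
    then have "k \<le> m" "sorted (drop (m - k) w)" by (auto simp: S_def)
    then have "\<not> avoids k w" unfolding avoids_def using m
      by (intro notI, elim allE[of _ "m - k"]) (simp add: sorted_wrt_take)
    then show False using True by simp
  qed
  ultimately show ?thesis using sum_psi_initial[OF k] \<open>R = S\<close> by simp
next
  case False
  \<comment> \<open>\<open>Q j\<close> says that a streak starts at position \<open>j\<close>; thus
    \<open>l\<close> is the start of the first streak.\<close>
  define Q where "Q j \<longleftrightarrow> j + k \<le> m \<and> sorted (take k (drop j w))" for j
  define l where "l = (LEAST j. Q j)"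
  from False have "\<exists>j. Q j" using m by (auto simp: Q_def avoids_def)
  then have Ql: "Q l" unfolding l_def by (rule LeastI_ex)
  have least: "l \<le> j" if "Q j" for j using that unfolding l_def by (rule Least_le)
  have lk: "l + k \<le> m" using Ql by (simp add: Q_def)
  have lw: "w ! i \<le> w ! Suc i" if "l \<le> i" "Suc i < l + k" for i
    using Ql that m lk by (auto simp: Q_def sorted_window_iff)
  have av: "avoids k (take i w) \<longleftrightarrow> i < l + k" if "i \<le> m" for i
  proof
    assume "avoids k (take i w)" then show "i < l + k"
      using Ql m that by (force simp: avoids_take_iff Q_def)
  next
    assume "i < l + k" then show "avoids k (take i w)"
      using least m that by (force simp: avoids_take_iff Q_def)
  qed
  show ?thesis
  \<comment> \<open>The prefix must stop before completing the first streak, so an admissible suffix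
    starts no later than \<open>l + k - 1\<close>, the last letter of that streak.\<close>
  proof (cases "sorted (drop (l + k - 1) w)")
    case False
    have "R = {}"
    proof (rule equals0I)
      fix r assume "r \<in> R"
      then have "m - r < l + k" "sorted (drop (m - r) w)" using av by (auto simp: R_def)
      then have "sorted (drop (l + k - 1) w)" by (auto simp: sorted_drop_iff)
      with False show False by simp
    qed
    then show ?thesis by simp
  next
    case True
    \<comment> \<open>The streak and the sorted suffix share the letter at \<open>l + k - 1\<close>,
      so every adjacent pair from \<open>l\<close> on lies in one of them.\<close>
    have sl: "sorted (drop l w)"
      unfolding sorted_drop_iff
    proof (intro allI impI)
      fix i assume i: "l \<le> i" "Suc i < length w"
      show "w ! i \<le> w ! Suc i"
      proof (cases "Suc i < l + k")
        case True then show ?thesis using i lw by simp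
      next
        case False
        then show ?thesis using i True by (auto simp: sorted_drop_iff)
      qed
    qed
    \<comment> \<open>A sorted suffix that started before \<open>l\<close> would already give a
      streak at \<open>l - 1\<close>.\<close>
    have ns: "l \<le> i" if i: "i \<le> m" "sorted (drop i w)" for i
    proof (rule ccontr)
      assume "\<not> l \<le> i"
      then have "Q (l - 1)" using i lk m k
        by (auto simp: Q_def sorted_drop_iff sorted_window_iff)
      then show False using least[of "l - 1"] \<open>\<not> l \<le> i\<close> by simp
    qed
    have "R = {m + 1 - l - k..<m + 1 - l - k + k}"
    proof (rule set_eqI)
      fix r
      have "r \<in> R \<longleftrightarrow> r \<le> m \<and> m - r < l + k \<and> sorted (drop (m - r) w)"
        using av by (auto simp: R_def)
      also have "\<dots> \<longleftrightarrow> r \<le> m \<and> m - r < l + k \<and> l \<le> m - r"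
        using ns[of "m - r"] sl by (auto simp: sorted_drop_iff)
      also have "\<dots> \<longleftrightarrow> r \<in> {m + 1 - l - k..<m + 1 - l - k + k}" using lk k by auto
      finally show "r \<in> R \<longleftrightarrow> r \<in> {m + 1 - l - k..<m + 1 - l - k + k}" .
    qed
    then show ?thesis by (simp only: sum_psi_period[OF k])
  qed
qed

text \<open>Double counting: each product counts the words with an admissible suffix of length
  \<open>r\<close>. After exchanging the sums, the contribution of every single word
  vanishes.\<close>

lemma sum_psi_sorted_avoid:
  assumes k: "k \<ge> 2" and m: "m \<ge> 1"
  shows "(\<Sum>r\<le>m. psi k (int r) * int (sorted_count n r) * int (avoid_count n k (m - r))) = 0"
proof -
  let ?P = "\<lambda>r w. avoids k (take (m - r) w) \<and> sorted (drop (m - r) w)"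
  have "(\<Sum>r\<le>m. psi k (int r) * int (sorted_count n r) * int (avoid_count n k (m - r))) =
      (\<Sum>r\<le>m. psi k (int r) * int (card {w \<in> words n m. ?P r w}))"
  proof (rule sum.cong)
    fix r assume "r \<in> {..m}"
    then have "card {w \<in> words n m. ?P r w} = avoid_count n k (m - r) * sorted_count n r"
      using card_append_words[of n "m - r" r "avoids k" sorted]
      by (simp add: avoid_count_def sorted_count_def)
    then show "psi k (int r) * int (sorted_count n r) * int (avoid_count n k (m - r)) =
        psi k (int r) * int (card {w \<in> words n m. ?P r w})" by simp
  qed simp
  also have "\<dots> = (\<Sum>r\<le>m. \<Sum>w\<in>{w \<in> words n m. ?P r w}. psi k (int r))"
    by (simp add: mult.commute)
  also have "\<dots> = (\<Sum>w\<in>words n m. \<Sum>r\<in>{r\<in>{..m}. ?P r w}. psi k (int r))"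
    by (rule sum.swap_restrict) (auto simp: finite_words)
  also have "\<dots> = 0"
  proof (rule sum.neutral, rule ballI)
    fix w assume "w \<in> words n m"
    then have "length w = m" by (simp add: words_def)
    from sum_psi_splits_eq_0[OF k this m]
    show "(\<Sum>r\<in>{r\<in>{..m}. ?P r w}. psi k (int r)) = 0" by simp
  qed
  finally show ?thesis .
qed

section \<open>Generating function of the non-decreasing words\<close>

lemma sorted_count_0_right [simp]: "sorted_count n 0 = 1"
proof -
  have "{w \<in> words n 0. sorted w} = {[]}" by (auto simp: words_def)
  then show ?thesis by (simp add: sorted_count_def)
qed

lemma sorted_count_0_left: "sorted_count 0 (Suc r) = 0"
  by (auto simp: sorted_count_def words_def)

text \<open>A non-decreasing word either omits the largest letter or ends with it, and in the latter
  case that last letter can be removed.\<close>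

lemma sorted_count_Suc:
  "sorted_count (Suc n) (Suc r) = sorted_count n (Suc r) + sorted_count (Suc n) r"
proof -
  let ?f = "\<lambda>w. w @ [Suc n]"
  have "{w \<in> words (Suc n) (Suc r). sorted w} =
      {w \<in> words n (Suc r). sorted w} \<union> ?f ` {w \<in> words (Suc n) r. sorted w}" (is "?L = ?A \<union> ?B")
  proof
    show "?L \<subseteq> ?A \<union> ?B"
    proof
      fix w assume w: "w \<in> ?L"
      then obtain v x where v: "w = v @ [x]" by (cases w rule: rev_cases) (auto simp: words_def)
      show "w \<in> ?A \<union> ?B"
      proof (cases "x = Suc n")
        case True then show ?thesis using w v by (auto simp: words_def sorted_append)
      next
        case False
        then have "x \<le> n" using w v by (auto simp: words_def)
        moreover have "\<forall>y\<in>set w. y \<le> x" using w v by (auto simp: sorted_append)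
        ultimately have "w \<in> ?A" using w by (fastforce simp: words_def)
        then show ?thesis by simp
      qed
    qed
    show "?A \<union> ?B \<subseteq> ?L" by (fastforce simp: words_def sorted_append)
  qed
  moreover have "?A \<inter> ?B = {}" by (auto simp: words_def)
  moreover have "card ?B = card {w \<in> words (Suc n) r. sorted w}"
    by (rule card_image) (simp add: inj_on_def)
  ultimately show ?thesis
    unfolding sorted_count_def by (simp add: card_Un_disjoint finite_words)
qed

text \<open>In this form, enlarging the alphabet by one letter is a Cauchy product with the
  geometric series, which drives the two inductions that follow.\<close>

lemma sorted_count_eq_sum: "sorted_count (Suc n) r = (\<Sum>j\<le>r. sorted_count n j)"
  by (induction r) (simp_all add: sorted_count_Suc)

lemma summable_sorted_count:
  fixes x :: real
  assumes "0 \<le> x" "x < 1"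
  shows "summable (\<lambda>r. real (sorted_count n r) * x ^ r)"
proof (induction n)
  case 0
  show ?case
    by (rule summable_finite[of "{0}"]) (auto simp: sorted_count_0_left gr0_conv_Suc)
next
  case (Suc n)
  have "summable (\<lambda>r. \<Sum>i\<le>r. (real (sorted_count n i) * x ^ i) * x ^ (r - i))"
    using Suc assms by (intro summable_Cauchy_product) (simp_all add: summable_geometric)
  also have "(\<lambda>r. \<Sum>i\<le>r. (real (sorted_count n i) * x ^ i) * x ^ (r - i)) =
      (\<lambda>r. real (sorted_count (Suc n) r) * x ^ r)"
    by (auto simp: sorted_count_eq_sum sum_distrib_right mult.assoc simp flip: power_add intro!: sum.cong)
  finally show ?case .
qed

lemma sorted_count_sums:
  fixes z :: complex
  assumes "norm z < 1"
  shows "(\<lambda>r. of_nat (sorted_count n r) * z ^ r) sums (1 / (1 - z)) ^ n"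
proof (induction n)
  case 0
  have "(\<lambda>r. of_nat (sorted_count 0 r) * z ^ r) = (\<lambda>r. if r = 0 then 1 else 0)"
    by (rule ext) (auto simp: sorted_count_0_left gr0_conv_Suc)
  then show ?case using sums_single[of 0 "\<lambda>_. 1 :: complex"] by simp
next
  case (Suc n)
  have "(\<lambda>r. \<Sum>i\<le>r. (of_nat (sorted_count n i) * z ^ i) * z ^ (r - i)) sums
      ((\<Sum>r. of_nat (sorted_count n r) * z ^ r) * (\<Sum>r. z ^ r))"
    using assms summable_sorted_count[of "norm z" n]
    by (intro Cauchy_product_sums) (simp_all add: norm_mult norm_power summable_geometric)
  also have "(\<lambda>r. \<Sum>i\<le>r. (of_nat (sorted_count n i) * z ^ i) * z ^ (r - i)) =
      (\<lambda>r. of_nat (sorted_count (Suc n) r) * z ^ r)"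
    by (auto simp: sorted_count_eq_sum sum_distrib_right mult.assoc simp flip: power_add intro!: sum.cong)
  finally show ?case
    using assms Suc by (simp add: sums_iff suminf_geometric)
qed

section \<open>The waiting time: its tail events and measurability\<close>

lemma sorted_window_map:
  assumes "j + k \<le> m"
  shows "take k (drop j (map x [0..<m])) = map x [j..<j + k]"
  using assms by (simp add: take_map drop_map)

text \<open>A streak completed after \<open>i\<close> letters is the window starting at
  \<open>i - k\<close>. Hence the event that the waiting time exceeds \<open>m\<close> depends on
  the first \<open>m\<close> letters only.\<close>

lemma less_letters_drawn_iff:
  "enat m < letters_drawn k x \<longleftrightarrow> avoids k (map x [0..<m])"
proof
  assume L: "enat m < letters_drawn k x"
  show "avoids k (map x [0..<m])"
    unfolding avoids_def
  proof (intro allI impI notI)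
    fix j assume j: "j + k \<le> length (map x [0..<m])"
      and "sorted (take k (drop j (map x [0..<m])))"
    then have "sorted (map x [j..<j + k])" by (simp add: sorted_window_map)
    then have "letters_drawn k x \<le> enat (j + k)"
      unfolding letters_drawn_def soft_streak_def by (intro INF_lower) simp
    also have "enat (j + k) \<le> enat m" using j by simp
    finally show False using L by simp
  qed
next
  assume A: "avoids k (map x [0..<m])"
  \<comment> \<open>Bounding every member of an infimum gives only a weak inequality; the bound
    \<open>Suc m\<close> makes it strict over \<open>m\<close>.\<close>
  have "enat (Suc m) \<le> letters_drawn k x"
    unfolding letters_drawn_def
  proof (rule INF_greatest)
    fix i assume i: "i \<in> {i. k \<le> i \<and> soft_streak k (map x [i - k..<i])}"
    have "\<not> i \<le> m"
    proof
      assume "i \<le> m"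
      then have "take k (drop (i - k) (map x [0..<m])) = map x [i - k..<i]"
        using i sorted_window_map[of "i - k" k m x] by simp
      then show False using A i \<open>i \<le> m\<close>
        unfolding avoids_def by (auto simp: soft_streak_def dest!: spec[of _ "i - k"])
    qed
    then show "enat (Suc m) \<le> enat i" by simp
  qed
  then show "enat m < letters_drawn k x"
    by (simp add: Suc_ile_eq)
qed

lemma soft_streak_map_upt:
  "soft_streak k (map x [a..<b]) \<longleftrightarrow> b - a = k \<and> (\<forall>i. Suc i < b - a \<longrightarrow> x (a + i) \<le> x (a + Suc i))"
  unfolding soft_streak_def sorted_iff_nth_Suc
  by (intro conj_cong) (simp_all del: upt_Suc)

lemma soft_streak_pred:
  assumes X: "\<And>i. X i \<in> measurable M (count_space UNIV)"
  shows "Measurable.pred M (\<lambda>\<xi>. soft_streak k (map (\<lambda>i. X i \<xi>) [a..<b]))"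
proof -
  \<comment> \<open>\<open>X j\<close> takes countably many values, so it may be replaced by a
    constant \<open>a\<close>.\<close>
  have [measurable]: "Measurable.pred M (\<lambda>\<xi>. X i \<xi> \<le> X j \<xi>)" for i j
    by (rule measurable_compose_countable[OF _ X, where f = "\<lambda>a \<xi>. X i \<xi> \<le> a"])
      (rule measurable_compose[OF X], simp)
  show ?thesis
    unfolding soft_streak_map_upt
    by (intro pred_intros_logic pred_intros_countable) measurable
qed

lemma measurable_INF_enat:
  assumes [measurable]: "\<And>m. Measurable.pred M (P m)"
  shows "(\<lambda>\<xi>. INF m. if k \<le> m \<and> P m \<xi> then enat m else \<infinity>) \<in> measurable M (count_space UNIV)"
  by (intro measurable_INF measurable_If) auto

lemma letters_drawn_measurable:
  assumes "\<And>i. X i \<in> measurable M (count_space UNIV)"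
  shows "(\<lambda>\<xi>. letters_drawn k (\<lambda>i. X i \<xi>)) \<in> measurable M (count_space UNIV)"
proof -
  \<comment> \<open>The index set of the infimum depends on the outcome. Giving the excluded
    \<open>m\<close> the value \<infinity> makes the index set fixed and leaves the infimum
    unchanged.\<close>
  have eq: "letters_drawn k x =
      (INF m. if k \<le> m \<and> soft_streak k (map x [m - k..<m]) then enat m else \<infinity>)" for x
    unfolding letters_drawn_def
  proof (rule antisym)
    show "(INF m\<in>{m. k \<le> m \<and> soft_streak k (map x [m - k..<m])}. enat m) \<le>
        (INF m. if k \<le> m \<and> soft_streak k (map x [m - k..<m]) then enat m else \<infinity>)"
      by (rule INF_greatest) (auto intro: INF_lower)
    show "(INF m. if k \<le> m \<and> soft_streak k (map x [m - k..<m]) then enat m else \<infinity>) \<le>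
        (INF m\<in>{m. k \<le> m \<and> soft_streak k (map x [m - k..<m])}. enat m)"
    proof (rule INF_greatest)
      fix i assume "i \<in> {m. k \<le> m \<and> soft_streak k (map x [m - k..<m])}"
      then show "(INF m. if k \<le> m \<and> soft_streak k (map x [m - k..<m]) then enat m else \<infinity>) \<le> enat i"
        by (intro INF_lower2[of i]) auto
    qed
  qed
  show ?thesis
    unfolding eq by (rule measurable_INF_enat) (rule soft_streak_pred[OF assms])
qed

section \<open>Probabilities of words and the tail formula for the expectation\<close>

locale uniform_letters = prob_space M for M :: "'a measure" +
  fixes X :: "nat \<Rightarrow> 'a \<Rightarrow> nat" and n :: nat
  assumes indep: "indep_vars (\<lambda>_. count_space UNIV) X UNIV"
    and uniform: "\<And>i. distr M (count_space UNIV) (X i) = measure_pmf (pmf_of_set {1..n})"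
    and n_pos: "n \<ge> 1"
begin

lemma X_measurable [measurable]: "X i \<in> measurable M (count_space UNIV)"
  using indep by (simp add: indep_vars_def)

lemma prob_X_eq: "a \<in> {1..n} \<Longrightarrow> prob (X i -` {a} \<inter> space M) = 1 / real n"
proof -
  assume a: "a \<in> {1..n}"
  have "prob (X i -` {a} \<inter> space M) = measure (distr M (count_space UNIV) (X i)) {a}"
    by (simp add: measure_distr)
  also have "\<dots> = pmf (pmf_of_set {1..n}) a"
    unfolding uniform by (simp add: pmf.rep_eq)
  also have "\<dots> = 1 / real n"
    using a n_pos by (subst pmf_of_set) auto
  finally show ?thesis .
qed

lemma AE_letters: "AE \<xi> in M. \<forall>i. X i \<xi> \<in> {1..n}"
  unfolding AE_all_countable
proof
  fix i
  have "AE a in measure_pmf (pmf_of_set {1..n}). a \<in> {1..n}"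
    using n_pos by (simp add: AE_measure_pmf_iff)
  then have "AE a in distr M (count_space UNIV) (X i). a \<in> {1..n}"
    by (simp only: uniform)
  then show "AE \<xi> in M. X i \<xi> \<in> {1..n}"
    by (subst (asm) AE_distr_iff) auto
qed

text \<open>For \<open>m = 0\<close> the intersection would be \<open>UNIV\<close> instead of
  \<open>space M\<close>.\<close>

lemma map_eq_INT:
  assumes "length w = m" "m > 0"
  shows "{\<xi> \<in> space M. map (\<lambda>i. X i \<xi>) [0..<m] = w} = (\<Inter>i\<in>{..<m}. X i -` {w ! i} \<inter> space M)"
  using assms by (auto simp: list_eq_iff_nth_eq)

lemma map_eq_sets: "{\<xi> \<in> space M. map (\<lambda>i. X i \<xi>) [0..<m] = w} \<in> sets M"
proof -
  have "{\<xi> \<in> space M. map (\<lambda>i. X i \<xi>) [0..<m] = w} =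
      {\<xi> \<in> space M. length w = m \<and> (\<forall>i<m. X i \<xi> = w ! i)}"
    by (auto simp: list_eq_iff_nth_eq)
  also have "\<dots> \<in> sets M" by measurable
  finally show ?thesis .
qed

lemma prob_word:
  assumes w: "w \<in> words n m"
  shows "prob {\<xi> \<in> space M. map (\<lambda>i. X i \<xi>) [0..<m] = w} = (1 / real n) ^ m"
proof (cases "m = 0")
  case True
  then show ?thesis using w prob_space by (simp add: words_def)
next
  case False
  have "prob {\<xi> \<in> space M. map (\<lambda>i. X i \<xi>) [0..<m] = w} =
      prob (\<Inter>i\<in>{..<m}. X i -` {w ! i} \<inter> space M)"
    using w False by (subst map_eq_INT) (auto simp: words_def)
  also have "\<dots> = (\<Prod>i<m. prob (X i -` {w ! i} \<inter> space M))"
    using False by (intro indep_varsD[OF indep]) auto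
  also have "\<dots> = (\<Prod>i<m. 1 / real n)"
    using w by (intro prod.cong refl prob_X_eq) (auto simp: words_def dest: nth_mem)
  finally show ?thesis by simp
qed

text \<open>Almost surely all letters lie in \<open>{1..n}\<close>, so up to a null set
  \<open>E\<close> is the disjoint union of the events that the first \<open>m\<close> letters spell
  a given word of \<open>W\<close>.\<close>

lemma prob_words:
  assumes W: "W \<subseteq> words n m" and E: "E \<in> sets M"
    and EW: "\<And>\<xi>. \<xi> \<in> space M \<Longrightarrow> map (\<lambda>i. X i \<xi>) [0..<m] \<in> words n m \<Longrightarrow>
      \<xi> \<in> E \<longleftrightarrow> map (\<lambda>i. X i \<xi>) [0..<m] \<in> W"
  shows "prob E = real (card W) / real n ^ m"
proof -
  let ?F = "\<lambda>w. {\<xi> \<in> space M. map (\<lambda>i. X i \<xi>) [0..<m] = w}"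
  have fin: "finite W" using W finite_words finite_subset by blast
  have "prob E = prob (\<Union>w\<in>W. ?F w)"
  proof (rule finite_measure_eq_AE)
    show "AE \<xi> in M. \<xi> \<in> E \<longleftrightarrow> \<xi> \<in> (\<Union>w\<in>W. ?F w)"
      using AE_letters AE_space
    proof eventually_elim
      case (elim \<xi>)
      then have "map (\<lambda>i. X i \<xi>) [0..<m] \<in> words n m" by (force simp: words_def)
      then show ?case using EW elim by auto
    qed
    show "(\<Union>w\<in>W. ?F w) \<in> sets M"
      using fin by (intro sets.finite_UN map_eq_sets) auto
  qed (fact E)
  also have "\<dots> = (\<Sum>w\<in>W. prob (?F w))"
    using fin map_eq_sets
    by (intro finite_measure_finite_Union) (auto simp: disjoint_family_on_def image_subset_iff)
  also have "\<dots> = (\<Sum>w\<in>W. (1 / real n) ^ m)"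
    using W by (intro sum.cong refl prob_word) auto
  finally show ?thesis by (simp add: power_divide)
qed

lemma prob_letters_drawn_gt:
  "prob {\<xi> \<in> space M. enat m < letters_drawn k (\<lambda>i. X i \<xi>)} = real (avoid_count n k m) / real n ^ m"
  unfolding avoid_count_def
proof (rule prob_words)
  have [measurable]: "(\<lambda>\<xi>. letters_drawn k (\<lambda>i. X i \<xi>)) \<in> measurable M (count_space UNIV)"
    by (rule letters_drawn_measurable) measurable
  show "{\<xi> \<in> space M. enat m < letters_drawn k (\<lambda>i. X i \<xi>)} \<in> sets M"
    by measurable
qed (auto simp: less_letters_drawn_iff)

lemma expected_letters_eq_suminf:
  "expected_letters M X k = (\<Sum>m. ennreal (real (avoid_count n k m) / real n ^ m))"
  unfolding expected_letters_def
  using nn_integral_enat_function[OF letters_drawn_measurable[OF X_measurable]]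
  by (simp add: emeasure_eq_measure prob_letters_drawn_gt)

end

section \<open>Geometric decay of the tail\<close>

lemma avoid_count_le: "avoid_count n k m \<le> n ^ m"
  unfolding avoid_count_def card_words[symmetric]
  by (intro card_mono finite_words) auto

text \<open>The \<open>k\<close> letters after an avoiding prefix must not be sorted; this excludes
  at least the constant word of ones.\<close>

lemma avoid_count_add_le:
  assumes "n \<ge> 1"
  shows "avoid_count n k (m + k) \<le> avoid_count n k m * (n ^ k - 1)"
proof -
  have "avoid_count n k (m + k) \<le>
      card {w \<in> words n (m + k). avoids k (take m w) \<and> \<not> sorted (drop m w)}"
    unfolding avoid_count_def
  proof (intro card_mono subsetI)
    fix w assume w: "w \<in> {w \<in> words n (m + k). avoids k w}"
    then have "length w = m + k" "avoids k w" by (auto simp: words_def)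
    moreover have "\<not> sorted (drop m w)"
      using calculation by (auto simp: avoids_def dest!: spec[of _ m])
    moreover have "avoids k (take m w)"
      using calculation avoids_take_iff[of m w k] by (auto simp: avoids_def)
    ultimately show "w \<in> {w \<in> words n (m + k). avoids k (take m w) \<and> \<not> sorted (drop m w)}"
      using w by simp
  qed (simp add: finite_words)
  also have "\<dots> = avoid_count n k m * card {w \<in> words n k. \<not> sorted w}"
    unfolding avoid_count_def by (rule card_append_words)
  also have "card {w \<in> words n k. \<not> sorted w} \<le> card (words n k - {replicate k 1})"
    using assms by (intro card_mono) (auto simp: finite_words)
  also have "\<dots> = n ^ k - 1"
    using assms by (subst card_Diff_singleton) (auto simp: card_words, auto simp: words_def)
  finally show ?thesis by simp
qed

text \<open>Each block of \<open>k\<close> letters shrinks the tail by a factor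
  \<open>c < 1\<close>. A partial sum \<open>s\<close> therefore satisfies
  \<open>s \<le> k + c * s\<close>, which bounds it by \<open>k / (1 - c)\<close>.\<close>

lemma summable_avoid_count:
  assumes n: "n \<ge> 1"
  shows "summable (\<lambda>m. real (avoid_count n k m) / real n ^ m)"
proof -
  define p where "p m = real (avoid_count n k m) / real n ^ m" for m
  define c where "c = 1 - 1 / real n ^ k"
  have c: "0 \<le> c" "c < 1" using n by (auto simp: c_def)
  have p0: "0 \<le> p m" for m by (simp add: p_def)
  have p1: "p m \<le> 1" for m
  proof -
    have "real (avoid_count n k m) \<le> real (n ^ m)" using avoid_count_le by (simp only: of_nat_le_iff)
    then show ?thesis using n by (simp add: p_def field_simps)
  qed
  have pc: "p (m + k) \<le> c * p m" for m
  proof -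
    have "real (avoid_count n k (m + k)) \<le> real (avoid_count n k m * (n ^ k - 1))"
      using avoid_count_add_le[OF n] by (simp only: of_nat_le_iff)
    also have "\<dots> = real (avoid_count n k m) * (real n ^ k - 1)"
      using n by (simp add: of_nat_diff)
    finally show ?thesis using n by (simp add: p_def c_def field_simps power_add)
  qed
  have "(\<Sum>m<N. p m) \<le> real k / (1 - c)" for N
  proof -
    have "(\<Sum>m<N. p m) \<le> (\<Sum>m<k + N. p m)"
      by (intro sum_mono2) (auto simp: p0)
    also have "\<dots> = (\<Sum>m<k. p m) + (\<Sum>m<N. p (m + k))"
      using sum.atLeastLessThan_concat[of 0 k "k + N" p] sum.shift_bounds_nat_ivl[of p 0 k N]
      by (simp add: lessThan_atLeast0 add.commute)
    also have "\<dots> \<le> (\<Sum>m<k. 1) + (\<Sum>m<N. c * p m)"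
      by (intro add_mono sum_mono p1 pc)
    finally have "(\<Sum>m<N. p m) \<le> real k + c * (\<Sum>m<N. p m)"
      by (simp add: sum_distrib_left)
    then show ?thesis using c by (simp add: field_simps)
  qed
  then have "summable p" by (intro summableI_nonneg_bounded p0)
  then show ?thesis by (simp add: p_def[abs_def])
qed

section \<open>The product of the two series\<close>

lemma summable_psi_sorted_count:
  assumes "norm (z :: 'a :: {real_normed_field, banach}) < 1"
  shows "summable (\<lambda>r. norm (of_int (psi k (int r)) * of_nat (sorted_count n r) * z ^ r))"
proof (rule summable_comparison_test')
  show "summable (\<lambda>r. real (sorted_count n r) * norm z ^ r)"
    using assms by (intro summable_sorted_count) auto
  show "norm (norm (of_int (psi k (int r)) * of_nat (sorted_count n r) * z ^ r)) \<le>
      real (sorted_count n r) * norm z ^ r" for r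
    by (auto simp: norm_mult norm_power psi_def)
qed

lemma suminf_avoid_times_suminf_psi_sorted:
  fixes n k :: nat
  assumes n: "n \<ge> 2" and k: "k \<ge> 2"
  shows "(\<Sum>r. of_int (psi k (int r)) * real (sorted_count n r) * (1 / real n) ^ r) *
    (\<Sum>m. real (avoid_count n k m) / real n ^ m) = 1"
proof -
  let ?d = "\<lambda>r. of_int (psi k (int r)) * real (sorted_count n r) * (1 / real n) ^ r"
  let ?p = "\<lambda>m. real (avoid_count n k m) / real n ^ m"
  have "(\<lambda>m. \<Sum>i\<le>m. ?d i * ?p (m - i)) sums ((\<Sum>r. ?d r) * (\<Sum>m. ?p m))"
  proof (rule Cauchy_product_sums)
    show "summable (\<lambda>r. norm (?d r))"
      using n summable_psi_sorted_count[of "1 / real n" k n] by simp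
    show "summable (\<lambda>m. norm (?p m))"
      using summable_avoid_count[of n k] n by simp
  qed
  moreover have "(\<Sum>i\<le>m. ?d i * ?p (m - i)) = (if m = 0 then 1 else 0)" for m
  proof (cases "m = 0")
    case True
    have "{w \<in> words n 0. avoids k w} = {[]}" using k by (auto simp: words_def avoids_def)
    then show ?thesis using True by (simp add: avoid_count_def psi_def cong_def)
  next
    case False
    \<comment> \<open>The powers of \<open>n\<close> combine to \<open>n ^ m\<close> in every term,
      so the integer convolution identity applies.\<close>
    have "(\<Sum>i\<le>m. ?d i * ?p (m - i)) =
        (\<Sum>i\<le>m. of_int (psi k (int i) * int (sorted_count n i) * int (avoid_count n k (m - i))) / real n ^ m)"
      using n by (intro sum.cong) (auto simp: power_divide simp flip: power_add)
    also have "\<dots> = of_int (\<Sum>i\<le>m. psi k (int i) * int (sorted_count n i) * int (avoid_count n k (m - i))) / real n ^ m"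
      by (simp add: sum_divide_distrib)
    also have "\<dots> = 0"
      using sum_psi_sorted_avoid[OF k, of m n] False by simp
    finally show ?thesis using False by simp
  qed
  moreover have "(\<lambda>m. if m = 0 then 1 else 0 :: real) sums 1"
    using sums_single[of 0 "\<lambda>_. 1 :: real"] by simp
  ultimately show ?thesis
    by (simp only: sums_unique2)
qed

section \<open>Roots of unity and the filter for \<open>psi\<close>\<close>

lemma root_omega_power: "root_omega k ^ j = exp (2 * of_real pi * \<i> * of_nat j / of_nat k)"
  unfolding root_omega_def exp_of_nat_mult[symmetric] by (simp add: mult_ac)

lemma root_omega_power_eq_1_iff:
  assumes "k \<ge> 1"
  shows "root_omega k ^ j = 1 \<longleftrightarrow> k dvd j"
  unfolding root_omega_power using assms by (rule complex_root_unity_eq_1)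

lemma norm_root_omega: "norm (root_omega k) = 1"
  unfolding root_omega_def by (simp add: norm_exp_eq_Re)

lemma root_omega_powi_minus:
  assumes "k \<ge> 1"
  shows "root_omega k powi (- int s) = root_omega k ^ ((k - 1) * s)"
proof -
  have "root_omega k ^ ((k - 1) * s) * root_omega k ^ s = root_omega k ^ (k * s)"
    using assms by (simp add: power_add[symmetric] algebra_simps)
  also have "\<dots> = 1" using assms by (simp add: root_omega_power_eq_1_iff)
  finally show ?thesis
    by (simp add: power_int_minus inverse_unique mult.commute)
qed

lemma sum_root_omega:
  assumes "k \<ge> 1"
  shows "(\<Sum>s<k. root_omega k ^ (s * j)) = (if k dvd j then of_nat k else 0)"
proof (cases "k dvd j")
  case True
  then have "root_omega k ^ (s * j) = 1" for s
    using assms by (simp add: root_omega_power_eq_1_iff)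
  then show ?thesis using True by simp
next
  case False
  let ?x = "root_omega k ^ j"
  have "?x \<noteq> 1" using False assms by (simp add: root_omega_power_eq_1_iff)
  moreover have "?x ^ k = 1"
    using assms by (simp add: root_omega_power_eq_1_iff flip: power_mult)
  ultimately have "(\<Sum>s<k. ?x ^ s) = 0" by (simp add: geometric_sum)
  then show ?thesis using False by (simp add: mult.commute flip: power_mult)
qed

text \<open>Discrete Fourier inversion: orthogonality of the powers of \<open>root_omega k\<close>
  detects the residues 0 and 1, which are distinct since \<open>k \<ge> 2\<close>.\<close>

lemma psi_root_filter:
  assumes k: "k \<ge> 2"
  shows "of_nat k * of_int (psi k (int r)) =
    (\<Sum>s = 1..k - 1. (1 - root_omega k powi (- int s)) * (root_omega k ^ s) ^ r)"
proof -
  \<comment> \<open>The added term \<open>s = 0\<close> has the factor \<open>1 - 1\<close>.\<close>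
  have "(\<Sum>s = 1..k - 1. (1 - root_omega k powi (- int s)) * (root_omega k ^ s) ^ r) =
      (\<Sum>s<k. (1 - root_omega k powi (- int s)) * (root_omega k ^ s) ^ r)"
  proof -
    have "{..<k} = insert 0 {1..k - 1}" using k by auto
    then show ?thesis by simp
  qed
  \<comment> \<open>The exponent \<open>r + (k - 1)\<close> stands for \<open>r - 1\<close> modulo
    \<open>k\<close> and keeps all exponents natural.\<close>
  also have "\<dots> = (\<Sum>s<k. root_omega k ^ (s * r) - root_omega k ^ (s * (r + (k - 1))))"
    using k by (intro sum.cong refl)
      (simp add: root_omega_powi_minus algebra_simps flip: power_mult power_add)
  also have "\<dots> = (if k dvd r then of_nat k else 0) - (if k dvd r + (k - 1) then of_nat k else 0)"
    using k by (simp add: sum_subtractf sum_root_omega)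
  also have "k dvd r + (k - 1) \<longleftrightarrow> [int r = 1] (mod int k)"
  proof -
    have "int (r + (k - 1)) = int r - 1 + int k" using k by simp
    then have "int k dvd int (r + (k - 1)) \<longleftrightarrow> int k dvd int r - 1"
      by (metis dvd_add_triv_right_iff)
    then show ?thesis by (simp only: cong_iff_dvd_diff int_dvd_int_iff)
  qed
  also have "k dvd r \<longleftrightarrow> [int r = 0] (mod int k)"
    by (simp add: cong_0_iff)
  also have "(if [int r = 0] (mod int k) then of_nat k else 0) -
      (if [int r = 1] (mod int k) then of_nat k else 0) = of_nat k * (of_int (psi k (int r)) :: complex)"
    using k by (auto simp: psi_def cong_def)
  finally show ?thesis by simp
qed

section \<open>Both denominators as sums over roots of unity\<close>

text \<open>The degree is at most \<open>(k - 1) * n\<close>, so the sum runs over all coefficients.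
  They are natural numbers, hence the transfer along \<open>of_nat\<close> before evaluating at
  \<open>x\<close>.\<close>

lemma calB_sum:
  fixes x :: "'a :: comm_ring_1"
  assumes "k \<ge> 1"
  shows "(\<Sum>r = 0..(k - 1) * n. of_nat (calB n k r) * x ^ r) = (\<Sum>i<k. x ^ i) ^ n"
proof -
  define P where "P = (\<Sum>i<k. monom (1::nat) i)"
  have "degree P \<le> k - 1"
    unfolding P_def by (intro degree_sum_le) (auto intro: order_trans[OF degree_monom_le])
  then have deg: "degree (P ^ n) \<le> (k - 1) * n"
    using degree_power_le[of P n] by (meson le_trans mult_le_mono1)
  have map_mult: "map_poly (of_nat :: nat \<Rightarrow> 'a) (Q * R) = map_poly of_nat Q * map_poly of_nat R" for Q R
    by (rule poly_eqI) (simp add: coeff_map_poly coeff_mult)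
  have map_power: "map_poly (of_nat :: nat \<Rightarrow> 'a) (Q ^ m) = map_poly of_nat Q ^ m" for Q m
    by (induction m) (simp_all add: map_mult map_poly_1)
  have "poly (map_poly of_nat (P ^ n)) x = (\<Sum>r = 0..(k - 1) * n. of_nat (coeff (P ^ n) r) * x ^ r)"
    (is "?l = _")
  proof -
    have "degree (map_poly (of_nat :: nat \<Rightarrow> 'a) (P ^ n)) \<le> (k - 1) * n"
      using deg by (intro degree_le) (auto simp: coeff_map_poly coeff_eq_0)
    then have "?l = (\<Sum>r\<le>(k - 1) * n. coeff (map_poly of_nat (P ^ n)) r * x ^ r)"
      unfolding poly_altdef by (intro sum.mono_neutral_left) (auto simp: coeff_eq_0)
    then show ?thesis by (simp add: coeff_map_poly atMost_atLeast0)
  qed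
  moreover have "map_poly (of_nat :: nat \<Rightarrow> 'a) P = (\<Sum>i<k. monom 1 i)"
    by (rule poly_eqI) (simp add: P_def coeff_map_poly coeff_sum)
  then have "poly (map_poly of_nat (P ^ n)) x = (\<Sum>i<k. x ^ i) ^ n"
    by (simp add: map_power poly_sum poly_monom)
  ultimately show ?thesis by (simp add: calB_def P_def)
qed

lemma norm_root_omega_div:
  assumes "n \<ge> 2"
  shows "norm (root_omega k ^ s / of_nat n) < 1"
  using assms by (simp add: norm_divide norm_power norm_root_omega)

text \<open>The root filter splits the series into finitely many generating functions of
  \<open>sorted_count\<close>, taken at points of norm \<open>1 / n < 1\<close>.\<close>

lemma suminf_psi_sorted_roots:
  assumes n: "n \<ge> 2" and k: "k \<ge> 2"
  shows "of_nat k * complex_of_real (\<Sum>r. of_int (psi k (int r)) * real (sorted_count n r) * (1 / real n) ^ r) =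
    (\<Sum>s = 1..k - 1. (1 - root_omega k powi (- int s)) *
       (1 - root_omega k ^ s / of_nat n) powi (- int n))"
proof -
  let ?d = "\<lambda>r. of_int (psi k (int r)) * real (sorted_count n r) * (1 / real n) ^ r"
  let ?c = "\<lambda>s. 1 - root_omega k powi (- int s)"
  let ?y = "\<lambda>s. root_omega k ^ s / of_nat n"
  have "summable ?d"
    using n by (intro summable_norm_cancel[OF summable_psi_sorted_count]) simp
  then have "?d sums (\<Sum>r. ?d r)" by (rule summable_sums)
  then have "(\<lambda>r. of_nat k * complex_of_real (?d r)) sums (of_nat k * complex_of_real (\<Sum>r. ?d r))"
    by (intro sums_mult sums_of_real)
  moreover have "of_nat k * complex_of_real (?d r) =
      (\<Sum>s = 1..k - 1. ?c s * (of_nat (sorted_count n r) * ?y s ^ r))" for r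
  proof -
    have "of_nat k * complex_of_real (?d r) =
        (of_nat k * of_int (psi k (int r))) * (of_nat (sorted_count n r) / of_nat n ^ r)"
      by (simp add: power_divide)
    also have "\<dots> = (\<Sum>s = 1..k - 1. ?c s * (of_nat (sorted_count n r) * ?y s ^ r))"
      unfolding psi_root_filter[OF k] sum_distrib_right
      by (intro sum.cong refl) (simp add: power_divide)
    finally show ?thesis .
  qed
  moreover have "(\<lambda>r. \<Sum>s = 1..k - 1. ?c s * (of_nat (sorted_count n r) * ?y s ^ r)) sums
      (\<Sum>s = 1..k - 1. ?c s * (1 / (1 - ?y s)) ^ n)"
    using norm_root_omega_div[OF n] by (intro sums_sum sums_mult sorted_count_sums)
  ultimately have "of_nat k * complex_of_real (\<Sum>r. ?d r) =
      (\<Sum>s = 1..k - 1. ?c s * (1 / (1 - ?y s)) ^ n)"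
    by (simp only: sums_unique2)
  then show ?thesis
    by (simp add: power_int_minus power_divide inverse_eq_divide)
qed

lemma psi_calB_sum_roots:
  assumes n: "n \<ge> 2" and k: "k \<ge> 2"
  shows "of_nat k * complex_of_real
      (\<Sum>r = 0..(k - 1) * n. of_int (psi k (int r)) * real (calB n k r) * real n powi (- int r)) =
    (1 - 1 / of_nat n ^ k) ^ n *
    (\<Sum>s = 1..k - 1. (1 - root_omega k powi (- int s)) *
       (1 - root_omega k ^ s / of_nat n) powi (- int n))"
proof -
  let ?c = "\<lambda>s. 1 - root_omega k powi (- int s)"
  let ?y = "\<lambda>s. root_omega k ^ s / of_nat n :: complex"
  have "of_nat k * complex_of_real
      (\<Sum>r = 0..(k - 1) * n. of_int (psi k (int r)) * real (calB n k r) * real n powi (- int r)) =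
      (\<Sum>r = 0..(k - 1) * n. (of_nat k * of_int (psi k (int r))) * (of_nat (calB n k r) / of_nat n ^ r))"
    by (simp add: sum_distrib_left power_int_minus divide_inverse mult.assoc)
  also have "\<dots> = (\<Sum>r = 0..(k - 1) * n. \<Sum>s = 1..k - 1. ?c s * (of_nat (calB n k r) * ?y s ^ r))"
    unfolding psi_root_filter[OF k] sum_distrib_right
    by (intro sum.cong refl) (simp add: power_divide)
  also have "\<dots> = (\<Sum>s = 1..k - 1. ?c s * (\<Sum>r = 0..(k - 1) * n. of_nat (calB n k r) * ?y s ^ r))"
    unfolding sum_distrib_left by (rule sum.swap)
  also have "\<dots> = (\<Sum>s = 1..k - 1. ?c s * ((1 - 1 / of_nat n ^ k) ^ n * (1 - ?y s) powi (- int n)))"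
  proof (intro sum.cong refl)
    fix s
    have "?y s \<noteq> 1" using norm_root_omega_div[OF n, of k s] by auto
    \<comment> \<open>This value does not depend on \<open>s\<close>, so the numerator of the
      geometric sum becomes a common factor of all terms.\<close>
    moreover have "?y s ^ k = 1 / of_nat n ^ k"
      using k by (simp add: power_divide root_omega_power_eq_1_iff flip: power_mult)
    ultimately have "(\<Sum>i<k. ?y s ^ i) = (1 - 1 / of_nat n ^ k) / (1 - ?y s)"
      by (simp only: sum_gp_strict if_False)
    then have "(\<Sum>r = 0..(k - 1) * n. of_nat (calB n k r) * ?y s ^ r) =
        ((1 - 1 / of_nat n ^ k) / (1 - ?y s)) ^ n"
      using calB_sum[of k n "?y s"] k by simp
    also have "\<dots> = (1 - 1 / of_nat n ^ k) ^ n * (1 - ?y s) powi (- int n)"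
      by (simp only: divide_inverse power_mult_distrib power_inverse power_int_minus power_int_of_nat)
    finally show "?c s * (\<Sum>r = 0..(k - 1) * n. of_nat (calB n k r) * ?y s ^ r) =
        ?c s * ((1 - 1 / of_nat n ^ k) ^ n * (1 - ?y s) powi (- int n))"
      by (simp only:)
  qed
  finally show ?thesis by (simp add: sum_distrib_left mult_ac)
qed

section \<open>The one-letter alphabet\<close>

lemma suminf_avoid_count_1: "(\<Sum>m. real (avoid_count 1 k m) / real 1 ^ m) = real k"
proof -
  have "{w \<in> words 1 m. avoids k w} = (if m < k then {replicate m 1} else {})" for m
  proof -
    have "words 1 m = {replicate m 1}"
      by (auto simp: words_def intro: replicate_eqI)
    moreover have "avoids k (replicate m 1) \<longleftrightarrow> m < k"
      by (auto simp: avoids_def not_le dest: spec[of _ 0])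
    ultimately show ?thesis by auto
  qed
  then have "real (avoid_count 1 k m) / real 1 ^ m = (if m \<in> {..<k} then 1 else 0)" for m
    by (simp add: avoid_count_def)
  then have "(\<lambda>m. real (avoid_count 1 k m) / real 1 ^ m) = (\<lambda>m. if m \<in> {..<k} then 1 else 0)"
    by (rule ext)
  then show ?thesis
    using sums_If_finite_set[of "{..<k}" "\<lambda>_. 1 :: real"] by (simp add: sums_iff)
qed

text \<open>For \<open>x \<noteq> 1\<close> of norm 1, \<open>(1 - 1/x) / (1 - x) = - 1/x\<close>.
  The inverses of all \<open>k\<close>-th roots of unity sum to 0, so those other than 1 sum to
  -1.\<close>

lemma sum_roots_1:
  assumes k: "k \<ge> 2"
  shows "(\<Sum>s = 1..k - 1. (1 - root_omega k powi (- int s)) *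
       (1 - root_omega k ^ s / of_nat 1) powi (- int 1)) = 1"
proof -
  have "(\<Sum>s = 1..k - 1. (1 - root_omega k powi (- int s)) *
       (1 - root_omega k ^ s / of_nat 1) powi (- int 1)) = (\<Sum>s = 1..k - 1. - (root_omega k ^ (s * (k - 1))))"
  proof (intro sum.cong refl)
    fix s assume s: "s \<in> {1..k - 1}"
    then have "root_omega k ^ s \<noteq> 1"
      using k by (auto simp: root_omega_power_eq_1_iff dest: dvd_imp_le)
    moreover have "root_omega k ^ s \<noteq> 0" using norm_root_omega[of k] by auto
    ultimately have "(1 - root_omega k powi (- int s)) * (1 - root_omega k ^ s / of_nat 1) powi (- int 1)
        = - (root_omega k powi (- int s))"
      by (simp add: power_int_minus field_simps)
    then show "(1 - root_omega k powi (- int s)) * (1 - root_omega k ^ s / of_nat 1) powi (- int 1)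
        = - (root_omega k ^ (s * (k - 1)))"
      using k by (simp add: root_omega_powi_minus mult.commute)
  qed
  also have "\<dots> = 1 - (\<Sum>s<k. root_omega k ^ (s * (k - 1)))"
  proof -
    have "{..<k} = insert 0 {1..k - 1}" using k by auto
    then show ?thesis by (simp add: sum_negf)
  qed
  also have "\<dots> = 1"
    using k by (subst sum_root_omega) (auto dest: dvd_imp_le)
  finally show ?thesis .
qed

text \<open>Finiteness is asserted separately because \<open>enn2real\<close> sends \<infinity> to
  0. The quotient with \<open>calB\<close> is restricted to \<open>n \<ge> 2\<close>: at
  \<open>n = 1\<close> its numerator and denominator are both 0.\<close>

theorem theorem4p2:
  fixes M :: "'a measure" and X :: "nat \<Rightarrow> 'a \<Rightarrow> nat" and n k :: nat
  assumes "n \<ge> 1" and "k \<ge> 2" and "iid_uniform_letters M X n"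
  shows "expected_letters M X k < \<infinity> \<and>
    (n \<ge> 2 \<longrightarrow>
      enn2real (expected_letters M X k) =
        (1 - real n powi (- int k)) ^ n /
        (\<Sum>r = 0..(k - 1) * n. of_int (psi k (int r)) * real (calB n k r) * real n powi (- int r))) \<and>
    complex_of_real (enn2real (expected_letters M X k)) =
      of_nat k /
      (\<Sum>s = 1..k - 1. (1 - root_omega k powi (- int s)) *
         (1 - root_omega k ^ s / of_nat n) powi (- int n))"
proof -
  interpret prob_space M using assms(3) by (simp add: iid_uniform_letters_def)
  interpret uniform_letters M X n
    using assms by unfold_locales (auto simp: iid_uniform_letters_def)
  define e where "e = (\<Sum>m. real (avoid_count n k m) / real n ^ m)"
  define S where "S = (\<Sum>s = 1..k - 1. (1 - root_omega k powi (- int s)) *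
         (1 - root_omega k ^ s / of_nat n) powi (- int n))"
  define N where "N = (\<Sum>r = 0..(k - 1) * n.
         of_int (psi k (int r)) * real (calB n k r) * real n powi (- int r))"
  have E: "expected_letters M X k = ennreal e"
    unfolding expected_letters_eq_suminf e_def
    using summable_avoid_count[OF assms(1)] by (intro suminf_ennreal2) auto
  have "e \<ge> 0"
    unfolding e_def using summable_avoid_count[OF assms(1)] by (intro suminf_nonneg) auto
  then have E': "enn2real (expected_letters M X k) = e" by (simp add: E)
  have "complex_of_real e = of_nat k / S \<and> (n \<ge> 2 \<longrightarrow> e = (1 - real n powi (- int k)) ^ n / N)"
  proof (cases "n = 1")
    case True
    then show ?thesis
      using suminf_avoid_count_1[of k] sum_roots_1[OF assms(2)] by (simp add: e_def S_def)
  next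
    case False
    then have n: "n \<ge> 2" using assms(1) by simp
    define D where "D = (\<Sum>r. of_int (psi k (int r)) * real (sorted_count n r) * (1 / real n) ^ r)"
    define q where "q = 1 - real n powi (- int k)"
    have De: "D * e = 1"
      unfolding D_def e_def by (rule suminf_avoid_times_suminf_psi_sorted[OF n assms(2)])
    then have D: "D \<noteq> 0" "e = 1 / D" by (auto simp: eq_divide_eq mult.commute)
    have kD: "of_nat k * complex_of_real D = S"
      unfolding D_def S_def by (rule suminf_psi_sorted_roots[OF n assms(2)])
    \<comment> \<open>\<open>N\<close> and \<open>D\<close> lead to the same sum \<open>S\<close>
      over roots; comparing them gives \<open>N = q ^ n * D\<close>, and the factor
      \<open>q ^ n\<close> is nonzero because \<open>n \<ge> 2\<close>.\<close>
    have "of_nat k * complex_of_real N = complex_of_real (q ^ n) * S"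
      unfolding N_def S_def q_def psi_calB_sum_roots[OF n assms(2)]
      by (simp add: power_int_minus inverse_eq_divide)
    also have "\<dots> = of_nat k * complex_of_real (q ^ n * D)"
      by (simp add: kD[symmetric])
    finally have N: "N = q ^ n * D"
      using assms(2) by (simp only: mult_cancel_left of_nat_eq_0_iff of_real_eq_iff) simp
    have "real n ^ k > 1" using n assms(2) by (intro one_less_power) auto
    then have "q \<noteq> 0" by (simp add: q_def power_int_minus field_simps)
    then have "e = q ^ n / N" using D N by simp
    moreover have "complex_of_real e = of_nat k / S"
      using D assms(2) by (simp add: kD[symmetric])
    ultimately show ?thesis by (simp add: q_def)
  qed
  then show ?thesis
    unfolding E' by (simp add: E S_def N_def)
qed

end
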